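(* Let $n,r\geq1$ and let $\mathbbm{n}\in\mathbb{Z}^{\mathbb{Z}_{nr}}$. If the homotopy class $\gamma(\mathbbm{n})$ contains a simple loop, then $r$ and $\underline{\mathbbm{n}}=\sum_{x\in\mathbb{Z}_{nr}}\mathbbm{n}_x$ are coprime and $\mathbbm{n}\sim\mathbbm{m}(r,\mathbb{d}(\mathbbm{n}))$.
   Context: $\mathbb{Z}_m=\mathbb{Z}/m\mathbb{Z}$ and $\mathbb{Z}^{\mathbb{Z}_m}$ is the set of functions $\mathbb{Z}_m\to\mathbb{Z}$ (cyclic integer sequences of length $m$). $\mathscr{T}^n$ is the quotient of $\mathbb{R}^2$ by $(r,s)\sim(r,s+1)$, $(r,s)\sim(r+n,s)$, with punctures at $(i+\frac12,\frac12)$, $i\in\mathbb{Z}_n$. Loops avoid the punctures and are considered up to homotopy in the complement of the punctures; a loop is simple if it has no self-intersections. For $\mathbbm{m}\in\mathbb{Z}^{\mathbb{Z}_{nr}}$, $\gamma(\mathbbm{m})$ is the homotopy class of the following closed path: for $x=0,1,\dots,nr-1$ successively, at the point $(x,0)$ travel $\mathbbm{m}_x$ times upwards along the vertical loop $\{x\}\times\mathbb{R}/\mathbb{Z}$ (downwards if $\mathbbm{m}_x<0$), then go right along the horizontal segment from $(x,0)$ to $(x+1,0)$. The multi-degree $\mathbb{d}(\mathbbm{m})\in\mathbb{Z}^{\mathbb{Z}_n}$ is $\mathbb{d}(\mathbbm{m})(i)=\sum_{j=0}^{r-1}\mathbbm{m}_{i+jn}$. Two sequences $\mathbbm{m},\mathbbm{m}'\in\mathbb{Z}^{\mathbb{Z}_{nr}}$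 are equivalent, $\mathbbm{m}\sim\mathbbm{m}'$, if there is $t\in n\mathbb{Z}$ with $\mathbbm{m}_x=\mathbbm{m}'_{x+t}$ for all $x$. For $\mathbb{d}\in\mathbb{Z}^{\mathbb{Z}_n}$ with $\sum_x\mathbb{d}(x)$ coprime to $r$, define $S_i$ by $S_0=0$, $S_{i+1}=S_i+\mathbb{d}(i)$ ($\mathbb{d}$ extended $n$-periodically); then $\mathbbm{m}(r,\mathbb{d})\in\mathbb{Z}^{\mathbb{Z}_{nr}}$ is given by $\mathbbm{m}(r,\mathbb{d})_i=|r\mathbb{Z}\cap(S_i,S_{i+1}]|$ if $S_{i+1}\geq S_i$, and $-|r\mathbb{Z}\cap(S_{i+1},S_i]|$ otherwise (well defined modulo $nr$). *)

theory Defs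
  imports "HOL-Analysis.Analysis"
begin

section \<open>Cyclic integer sequences\<close>

text \<open>A function on the integers modulo \<open>m\<close> is represented by its \<open>m\<close>-periodic lift
  to the integers.\<close>

definition cyclic_seq :: "nat \<Rightarrow> (int \<Rightarrow> int) \<Rightarrow> bool" where
  "cyclic_seq m f \<longleftrightarrow> (\<forall>x. f (x + int m) = f x)"

definition seq_total :: "nat \<Rightarrow> (int \<Rightarrow> int) \<Rightarrow> int" where
  "seq_total m f = (\<Sum>x\<in>{0..<int m}. f x)"

definition seq_equiv :: "nat \<Rightarrow> (int \<Rightarrow> int) \<Rightarrow> (int \<Rightarrow> int) \<Rightarrow> bool" where
  "seq_equiv n f g \<longleftrightarrow> (\<exists>t. int n dvd t \<and> (\<forall>x. f x = g (x + t)))"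

definition multidegree :: "nat \<Rightarrow> nat \<Rightarrow> (int \<Rightarrow> int) \<Rightarrow> int \<Rightarrow> int" where
  "multidegree n r f i = (\<Sum>j<r. f (i + int j * int n))"

text \<open>The unique solution of \<open>S 0 = 0\<close>, \<open>S (i + 1) = S i + d i\<close> over all integers; see
  \<open>partial_sum_0\<close> and \<open>partial_sum_step\<close> below.\<close>

definition partial_sum :: "(int \<Rightarrow> int) \<Rightarrow> int \<Rightarrow> int" where
  "partial_sum d i = (if 0 \<le> i then (\<Sum>j\<in>{0..<i}. d j) else - (\<Sum>j\<in>{i..<0}. d j))"

definition standard_seq :: "nat \<Rightarrow> (int \<Rightarrow> int) \<Rightarrow> int \<Rightarrow> int" where
  "standard_seq r d i =
     (if partial_sum d i \<le> partial_sum d (i + 1)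
      then int (card ({k. int r dvd k} \<inter> {partial_sum d i<..partial_sum d (i + 1)}))
      else - int (card ({k. int r dvd k} \<inter> {partial_sum d (i + 1)<..partial_sum d i})))"

lemma partial_sum_0: "partial_sum d 0 = 0"
  by (simp add: partial_sum_def)

lemma partial_sum_step: "partial_sum d (i + 1) = partial_sum d i + d i"
proof (cases "0 \<le> i")
  case True
  then have "{0..<i + 1} = insert i {0..<i}" by auto
  with True show ?thesis by (simp add: partial_sum_def)
next
  case False
  then have eq: "{i..<0} = insert i {i + 1..<0}" by auto
  show ?thesis
  proof (cases "i = - 1")
    case True
    have "{- 1..<0} = {- 1 :: int}" by auto
    with True show ?thesis by (simp add: partial_sum_def)
  next
    case False
    with \<open>\<not> 0 \<le> i\<close> show ?thesis by (simp add: partial_sum_def eq)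
  qed
qed


section \<open>The punctured torus\<close>

text \<open>The equivalence relation generated by \<open>(r, s) \<sim> (r, s + 1)\<close> and
  \<open>(r, s) \<sim> (r + n, s)\<close>.\<close>

definition torus_rel :: "nat \<Rightarrow> ((real \<times> real) \<times> (real \<times> real)) set" where
  "torus_rel n = {((r, s), (r', s')). \<exists>a b :: int. r' = r + of_int a * real n \<and> s' = s + of_int b}"

definition torus_proj :: "nat \<Rightarrow> real \<times> real \<Rightarrow> (real \<times> real) set" where
  "torus_proj n p = torus_rel n `` {p}"

text \<open>The quotient topology on the set of equivalence classes.\<close>

definition torus :: "nat \<Rightarrow> (real \<times> real) set topology" where
  "torus n = topology (\<lambda>U. U \<subseteq> UNIV // torus_rel n \<and> open (torus_proj n -` U))"

definition punctures :: "nat \<Rightarrow> (real \<times> real) set set" where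
  "punctures n = (\<lambda>i::int. torus_proj n (of_int i + 1/2, 1/2)) ` {0..<int n}"

definition punctured_torus :: "nat \<Rightarrow> (real \<times> real) set topology" where
  "punctured_torus n = subtopology (torus n) (- punctures n)"

lemma torus_rel_iff:
  "((x, y), (x', y')) \<in> torus_rel n \<longleftrightarrow>
     (\<exists>a b :: int. x' = x + of_int a * real n \<and> y' = y + of_int b)"
  by (simp add: torus_rel_def)

lemma equiv_torus_rel: "equiv UNIV (torus_rel n)"
proof (rule equivI)
  show "refl_on UNIV (torus_rel n)"
  proof (rule refl_onI, clarify)
    fix x y :: real
    have "x = x + of_int 0 * real n \<and> y = y + of_int 0" by simp
    then show "((x, y), (x, y)) \<in> torus_rel n" unfolding torus_rel_iff by blast
  qed
  show "sym (torus_rel n)"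
  proof (rule symI, clarify)
    fix x y x' y' :: real
    assume "((x, y), (x', y')) \<in> torus_rel n"
    then obtain a b :: int where "x' = x + of_int a * real n" "y' = y + of_int b"
      unfolding torus_rel_iff by blast
    then have "x = x' + of_int (- a) * real n \<and> y = y' + of_int (- b)" by simp
    then show "((x', y'), (x, y)) \<in> torus_rel n" unfolding torus_rel_iff by blast
  qed
  show "trans (torus_rel n)"
  proof (rule transI, clarify)
    fix x y x' y' x'' y'' :: real
    assume "((x, y), (x', y')) \<in> torus_rel n" "((x', y'), (x'', y'')) \<in> torus_rel n"
    then obtain a b a' b' :: int where "x' = x + of_int a * real n" "y' = y + of_int b"
      "x'' = x' + of_int a' * real n" "y'' = y' + of_int b'"
      unfolding torus_rel_iff by blast
    then have "x'' = x + of_int (a + a') * real n \<and> y'' = y + of_int (b + b')"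
      by (simp add: algebra_simps)
    then show "((x, y), (x'', y'')) \<in> torus_rel n" unfolding torus_rel_iff by blast
  qed
qed simp

lemma openin_torus:
  "openin (torus n) U \<longleftrightarrow> U \<subseteq> UNIV // torus_rel n \<and> open (torus_proj n -` U)"
proof -
  have "istopology (\<lambda>U. U \<subseteq> UNIV // torus_rel n \<and> open (torus_proj n -` U))"
    unfolding istopology_def by (auto simp: vimage_Int vimage_Union)
  then show ?thesis by (simp add: torus_def topology_inverse')
qed

lemma topspace_torus: "topspace (torus n) = UNIV // torus_rel n"
proof -
  have "torus_proj n -` (UNIV // torus_rel n) = UNIV"
    unfolding torus_proj_def by (blast intro: quotientI)
  then have "openin (torus n) (UNIV // torus_rel n)"
    by (simp add: openin_torus)
  then show ?thesis
    by (metis openin_subset openin_topspace openin_torus subset_antisym)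
qed

lemma quotient_map_torus_proj: "quotient_map euclidean (torus n) (torus_proj n)"
  unfolding quotient_map_def topspace_torus
  by (auto simp: openin_torus torus_proj_def quotient_def vimage_def)


section \<open>Loops\<close>

definition torus_loop :: "nat \<Rightarrow> (real \<Rightarrow> (real \<times> real) set) \<Rightarrow> bool" where
  "torus_loop n p \<longleftrightarrow> pathin (punctured_torus n) p \<and> p 0 = p 1"

definition simple_torus_loop :: "nat \<Rightarrow> (real \<Rightarrow> (real \<times> real) set) \<Rightarrow> bool" where
  "simple_torus_loop n p \<longleftrightarrow> torus_loop n p \<and> inj_on p {0..<1}"

text \<open>Free homotopy, without a fixed base point. The library's \<open>homotopic_loops\<close> is restricted
  to types of class \<open>topological_space\<close>; this is the same definition for the abstract topology
  \<open>punctured_torus n\<close>.\<close>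

definition torus_homotopic :: "nat \<Rightarrow> (real \<Rightarrow> (real \<times> real) set) \<Rightarrow> (real \<Rightarrow> (real \<times> real) set) \<Rightarrow> bool"
  where "torus_homotopic n p q \<longleftrightarrow>
    homotopic_with (\<lambda>c. c 1 = c 0) (top_of_set {0..1}) (punctured_torus n) p q"

text \<open>The path is written down in the plane and then projected: going up
  the vertical loop over \<open>x\<close> \<open>f x\<close> times is the image of the segment from \<open>(x, h)\<close> to
  \<open>(x, h + f x)\<close>, where the height \<open>h\<close> reached so far is an integer, so that horizontal
  segments are mapped to segments from \<open>(x, 0)\<close> to \<open>(x + 1, 0)\<close>. The recursion starts with a
  constant path.\<close>

definition height :: "(int \<Rightarrow> int) \<Rightarrow> nat \<Rightarrow> real" where
  "height f k = of_int (\<Sum>x<k. f (int x))"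

fun plane_walk :: "(int \<Rightarrow> int) \<Rightarrow> nat \<Rightarrow> real \<Rightarrow> real \<times> real" where
  "plane_walk f 0 = linepath (0, 0) (0, 0)"
| "plane_walk f (Suc x) =
     plane_walk f x
       +++ linepath (real x, height f x) (real x, height f (Suc x))
       +++ linepath (real x, height f (Suc x)) (real (Suc x), height f (Suc x))"

definition gamma_loop :: "nat \<Rightarrow> nat \<Rightarrow> (int \<Rightarrow> int) \<Rightarrow> real \<Rightarrow> (real \<times> real) set" where
  "gamma_loop n r f = torus_proj n \<circ> plane_walk f (n * r)"

definition gamma_class :: "nat \<Rightarrow> nat \<Rightarrow> (int \<Rightarrow> int) \<Rightarrow> (real \<Rightarrow> (real \<times> real) set) set" where
  "gamma_class n r f = {p. torus_loop n p \<and> torus_homotopic n (gamma_loop n r f) p}"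

lemma plane_walk_endpoints:
  "pathstart (plane_walk f k) = (0, 0)" "pathfinish (plane_walk f k) = (real k, height f k)"
  by (induction k) (simp_all add: height_def)

lemma path_plane_walk: "path (plane_walk f k)"
proof (induction k)
  case (Suc k)
  then show ?case
    by (simp add: plane_walk_endpoints)
qed (simp add: path_def)

lemma path_image_plane_walk: "path_image (plane_walk f k) \<subseteq> {(x, y). x \<in> \<int> \<or> y \<in> \<int>}"
proof (induction k)
  case (Suc k)
  have "path_image (linepath (real k, height f k) (real k, height f (Suc k))) \<subseteq> {(x, y). x \<in> \<int> \<or> y \<in> \<int>}"
    by (auto simp: path_image_def linepath_def algebra_simps)
  moreover have "path_image (linepath (real k, height f (Suc k)) (real (Suc k), height f (Suc k)))
      \<subseteq> {(x, y). x \<in> \<int> \<or> y \<in> \<int>}"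
    by (auto simp: path_image_def linepath_def height_def algebra_simps simp flip: of_int_add)
  ultimately show ?case
    using Suc unfolding plane_walk.simps
    by (intro subset_path_image_join) auto
qed auto

lemma torus_loop_gamma_loop: "torus_loop n (gamma_loop n r f)"
proof -
  have "continuous_map (top_of_set {0..1}) (torus n) (gamma_loop n r f)"
    unfolding gamma_loop_def
    by (rule continuous_map_compose[where X' = euclidean])
       (use path_plane_walk quotient_map_torus_proj in
         \<open>auto simp: path_def quotient_imp_continuous_map\<close>)
  moreover have "gamma_loop n r f t \<notin> punctures n" if t: "t \<in> {0..1}" for t
  proof
    assume "gamma_loop n r f t \<in> punctures n"
    then obtain i :: int where i: "torus_proj n (plane_walk f (n * r) t) = torus_proj n (of_int i + 1/2, 1/2)"
      by (auto simp: punctures_def gamma_loop_def)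
    then have "(plane_walk f (n * r) t, (of_int i + 1/2, 1/2)) \<in> torus_rel n"
      using equiv_torus_rel[of n] by (simp add: torus_proj_def eq_equiv_class)
    then obtain x y and a b :: int where xy: "plane_walk f (n * r) t = (x, y)"
      and x: "of_int i + 1/2 = x + of_int a * real n" and y: "1/2 = y + of_int b"
      unfolding torus_rel_def by (cases "plane_walk f (n * r) t") blast
    have half: "1/2 \<noteq> (of_int z :: real)" for z
    proof
      assume "1/2 = (of_int z :: real)"
      then have "(1 :: real) = of_int (2 * z)" by simp
      then have "1 = 2 * z" by linarith
      then show False by presburger
    qed
    from path_image_plane_walk[of f "n * r"] t xy have "x \<in> \<int> \<or> y \<in> \<int>"
      unfolding path_image_def by force
    then show False
    proof
      assume "x \<in> \<int>"
      then obtain z where "x = of_int z" by (elim Ints_cases)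
      with x have "1/2 = (of_int (z + a * int n - i) :: real)" by simp
      with half show False by blast
    next
      assume "y \<in> \<int>"
      then obtain z where "y = of_int z" by (elim Ints_cases)
      with y have "1/2 = (of_int (z + b) :: real)" by simp
      with half show False by blast
    qed
  qed
  moreover have "gamma_loop n r f 0 = gamma_loop n r f 1"
  proof -
    have ends: "plane_walk f (n * r) 0 = (0, 0)" "plane_walk f (n * r) 1 = (real (n * r), height f (n * r))"
      using plane_walk_endpoints[of f "n * r"] by (simp_all add: pathstart_def pathfinish_def)
    have "real (n * r) = 0 + of_int (int r) * real n
        \<and> height f (n * r) = 0 + of_int (\<Sum>x<n * r. f (int x))"
      by (simp add: height_def)
    then have "((0, 0), (real (n * r), height f (n * r))) \<in> torus_rel n"
      unfolding torus_rel_iff by blast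
    then show ?thesis
      using equiv_torus_rel[of n]
      by (simp add: gamma_loop_def ends torus_proj_def equiv_class_eq)
  qed
  ultimately show ?thesis
    by (auto simp: torus_loop_def pathin_def punctured_torus_def continuous_map_in_subtopology)
qed

end

theory Submission
  imports Defs "HOL-Complex_Analysis.Complex_Analysis" "HOL-Real_Asymp.Real_Asymp"
begin

text \<open>Write \<open>N\<close> for the total of \<open>f\<close>, \<open>V = (n r, N)\<close> and identify the plane with
  \<open>\<complex>\<close>. The homotopy lifts to the plane; the lift \<open>c\<close> of the simple loop satisfies
  \<open>c(1) = c(0) + V\<close> and never meets a lattice translate of itself, except by a multiple of \<open>V\<close>.
  The map \<open>z \<mapsto> exp (2 \<pi> i z / V)\<close> sends \<open>c\<close> to a loop around \<open>0\<close>, which has winding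
  number 1 around a point above \<open>c\<close> and 0 around a point below. Around the punctures these
  numbers are homotopy invariant, hence they record the partial sums \<open>h\<close> of \<open>f\<close>.

  If \<open>u\<close> is a lattice vector that is not a multiple of \<open>V\<close>, then \<open>c\<close> and \<open>c + u\<close> have disjoint
  images, so neither crosses the other: \<open>h\<close> and its translate by \<open>u\<close> are comparable. Taking
  \<open>u = (m n, q)\<close> with \<open>m N - q r = 1\<close>, the translates of \<open>h\<close> form a chain with step \<open>u\<close> in
  which \<open>r\<close> steps add 1, and this forces \<open>h(x) = \<lfloor>(S\<^sub>x + const) / r\<rfloor>\<close>, where \<open>S\<close>
  is the partial sum of the multi-degree.\<close>

section \<open>Winding numbers of a loop and its rotations\<close>

text \<open>This is the covering of the punctured plane whose deck transformations are the
  translations by integer multiples of \<open>w\<close> (for \<open>w\<close> nonzero). Translations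
  of the plane become multiplications by constants, and the side to the left of \<open>w\<close> is
  sent towards \<open>0\<close>.\<close>

definition wrap :: "complex \<Rightarrow> complex \<Rightarrow> complex" where
  "wrap w z = exp (2 * of_real pi * \<i> * (z / w))"

lemma wrap_nonzero [simp]: "wrap w z \<noteq> 0"
  by (simp add: wrap_def)

lemma wrap_add: "wrap w (z + z') = wrap w z * wrap w z'"
  by (simp add: wrap_def add_divide_distrib distrib_left exp_add)

lemma wrap_eq_iff:
  assumes "w \<noteq> 0"
  shows "wrap w z = wrap w z' \<longleftrightarrow> (\<exists>k::int. z = z' + of_int k * w)"
proof -
  have "(2 * of_real pi * \<i> * (z / w) = 2 * of_real pi * \<i> * (z' / w) + (of_int (2 * k) * pi) * \<i>)
      \<longleftrightarrow> z = z' + of_int k * w" for k :: int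
  proof -
    let ?c = "2 * of_real pi * \<i> / w"
    have "2 * of_real pi * \<i> * (z' / w) + (of_int (2 * k) * pi) * \<i>
        = ?c * (z' + of_int k * w)"
      using assms by (simp add: field_simps)
    moreover have "?c * z = ?c * (z' + of_int k * w) \<longleftrightarrow> z = z' + of_int k * w"
      using assms by (subst mult_cancel_left) auto
    ultimately show ?thesis by simp
  qed
  then show ?thesis by (simp add: wrap_def exp_eq)
qed

lemma continuous_on_wrap [continuous_intros]:
  "continuous_on S f \<Longrightarrow> continuous_on S (\<lambda>x. wrap w (f x))"
  unfolding wrap_def divide_inverse by (intro continuous_intros)

lemma winding_number_exp_lift:
  assumes "path q" and "\<And>t. t \<in> {0..1} \<Longrightarrow> p t = z + exp (q t)"
  shows "winding_number p z = (q 1 - q 0) / (2 * of_real pi * \<i>)"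
proof -
  have "winding_number p z = winding_number (\<lambda>t. p t - z) 0"
    by (rule winding_number_offset)
  also have "\<dots> = winding_number (exp \<circ> q) 0"
    by (rule winding_number_cong) (simp add: assms)
  also have "\<dots> = (q 1 - q 0) / (2 * of_real pi * \<i>)"
    using winding_number_compose_exp[OF assms(1)] by (simp add: pathstart_def pathfinish_def)
  finally show ?thesis .
qed

lemma winding_number_wrap:
  assumes "path c" "w \<noteq> 0" "pathfinish c = pathstart c + k * w"
  shows "winding_number (\<lambda>t. wrap w (c t)) 0 = k"
proof -
  have "winding_number (\<lambda>t. wrap w (c t)) 0
      = (2 * of_real pi * \<i> * (c 1 / w) - 2 * of_real pi * \<i> * (c 0 / w)) / (2 * of_real pi * \<i>)"
  proof (rule winding_number_exp_lift)
    show "path (\<lambda>t. 2 * of_real pi * \<i> * (c t / w))"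
      using assms(1) unfolding path_def divide_inverse by (intro continuous_intros)
  qed (simp add: wrap_def)
  also have "\<dots> = k"
    using assms by (simp add: pathstart_def pathfinish_def field_simps)
  finally show ?thesis .
qed

text \<open>Adding the constant \<open>Ln a\<close> to a continuous logarithm of
  \<open>p - z\<close> does not change its increment.\<close>

lemma winding_number_scale:
  assumes "path p" "z \<notin> path_image p" "a \<noteq> 0"
  shows "winding_number (\<lambda>t. a * p t) (a * z) = winding_number p z"
proof -
  obtain q where q: "path q" "pathfinish q - pathstart q = 2 * of_real pi * \<i> * winding_number p z"
      "\<And>t. t \<in> {0..1} \<Longrightarrow> p t = z + exp (q t)"
    using winding_number_as_continuous_log[OF assms(1,2)] by blast
  have "winding_number (\<lambda>t. a * p t) (a * z)
      = ((q 1 + Ln a) - (q 0 + Ln a)) / (2 * of_real pi * \<i>)"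
    using q assms
    by (intro winding_number_exp_lift)
       (auto simp: path_def exp_add distrib_left mult.commute intro!: continuous_intros)
  also have "\<dots> = winding_number p z"
    using q(2) by (simp add: pathstart_def pathfinish_def)
  finally show ?thesis .
qed

text \<open>The difference \<open>p t - q s\<close> has a continuous logarithm on the parameter square, so it
  turns along the diagonal as often as along two consecutive sides.\<close>

lemma winding_number_diff_add:
  assumes "path p" "path q" and disj: "path_image p \<inter> path_image q = {}"
  shows "winding_number (\<lambda>t. p t - q t) 0
    = winding_number p (q 0) + winding_number q (p 1)"
proof -
  let ?S = "{0..1::real} \<times> {0..1::real}"
  have cp: "continuous_on {0..1} p" "continuous_on {0..1} q" using assms by (auto simp: path_def)
  have ne: "p t \<noteq> q s" if "t \<in> {0..1}" "s \<in> {0..1}" for s t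
    using disj that unfolding path_image_def by blast
  have "continuous_on ?S (\<lambda>x. p (snd x) - q (fst x))"
    by (intro continuous_intros continuous_on_compose2[OF cp(1)] continuous_on_compose2[OF cp(2)]) auto
  moreover have "contractible ?S"
    by (intro convex_imp_contractible convex_Times) auto
  moreover have "p (snd x) - q (fst x) \<noteq> 0" if "x \<in> ?S" for x using ne that by auto
  ultimately obtain g where g: "continuous_on ?S g"
    "\<And>x. x \<in> ?S \<Longrightarrow> p (snd x) - q (fst x) = exp (g x)"
    by (rule continuous_logarithm_on_contractible) auto
  have 1: "winding_number (\<lambda>t. p t - q t) 0 = (g (1, 1) - g (0, 0)) / (2 * of_real pi * \<i>)"
    by (rule winding_number_exp_lift)
       (auto simp: path_def g(2)[symmetric] intro!: continuous_intros continuous_on_compose2[OF g(1)])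
  have 2: "winding_number p (q 0) = (g (0, 1) - g (0, 0)) / (2 * of_real pi * \<i>)"
    by (rule winding_number_exp_lift)
       (auto simp: path_def g(2)[symmetric] intro!: continuous_intros continuous_on_compose2[OF g(1)])
  \<comment> \<open>On this side the difference appears with the opposite sign, so its logarithm is
    \<open>g\<close> shifted by \<open>\<i> * pi\<close>; the shift cancels in the
    increment.\<close>
  have 3: "winding_number q (p 1)
      = ((g (1, 1) + \<i> * of_real pi) - (g (0, 1) + \<i> * of_real pi)) / (2 * of_real pi * \<i>)"
    by (rule winding_number_exp_lift)
       (auto simp: path_def g(2)[symmetric] exp_add intro!: continuous_intros continuous_on_compose2[OF g(1)])
  show ?thesis unfolding 1 2 3 by (simp add: field_simps)
qed

text \<open>A point sees at least one of two disjoint loops the way the other loop sees it: walk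
  straight to a nearest point of their union.\<close>

lemma winding_number_disjoint_loops:
  assumes p: "path p" "pathfinish p = pathstart p" and q: "path q" "pathfinish q = pathstart q"
    and disj: "path_image p \<inter> path_image q = {}"
  shows "winding_number p z = winding_number p (q 0) \<or> winding_number q z = winding_number q (p 1)"
proof -
  \<comment> \<open>If the nearest point \<open>y\<close> lies on \<open>q'\<close>, the segment
    from \<open>z\<close> to \<open>y\<close> followed by the image of \<open>q'\<close> is a
    connected set off \<open>p'\<close>; it contains both \<open>z\<close> and
    \<open>q' s\<close>.\<close>
  have near: "winding_number p' z = winding_number p' (q' s)"
    if "path p'" "pathfinish p' = pathstart p'" "path q'"
      and disj': "path_image p' \<inter> path_image q' = {}"
      and y: "y \<in> path_image q'" and le: "\<And>x. x \<in> path_image p' \<Longrightarrow> dist z y \<le> dist z x"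
      and s: "s \<in> {0..1}" for p' q' :: "real \<Rightarrow> complex" and y s
  proof -
    have "closed_segment z y \<inter> path_image p' = {}"
    proof (rule ccontr)
      assume "\<not> ?thesis"
      then obtain x where x: "x \<in> closed_segment z y" "x \<in> path_image p'" by blast
      have "dist z y = dist z x + dist x y"
        using x(1) by (metis between between_mem_segment)
      with le[OF x(2)] have "x = y" by simp
      with x(2) y disj' show False by blast
    qed
    moreover have "connected (closed_segment z y \<union> path_image q')"
      using y that(3) by (intro connected_Un connected_path_image) auto
    moreover have "q' s \<in> path_image q'" using s by (auto simp: path_image_def)
    ultimately show ?thesis
      using disj' that(1,2)
      by (intro winding_number_eq[of p' z "closed_segment z y \<union> path_image q'"]) auto
  qed
  have "path_image p \<union> path_image q \<noteq> {}" "closed (path_image p \<union> path_image q)"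
    using p q by (auto intro!: closed_Un closed_path_image)
  then obtain y where y: "y \<in> path_image p \<union> path_image q"
    and le: "\<And>x. x \<in> path_image p \<union> path_image q \<Longrightarrow> dist z y \<le> dist z x"
    using distance_attains_inf by metis
  from y show ?thesis
  proof
    assume "y \<in> path_image p"
    then show ?thesis using near[of q p y 1] p q disj le by auto
  next
    assume "y \<in> path_image q"
    then show ?thesis using near[of p q y 0] p q disj le by auto
  qed
qed

text \<open>Here the difference of the two loops is a multiple of \<open>p\<close>, so it winds around
  \<open>0\<close> as often as \<open>p\<close>; hence the mutual winding numbers of the loops add up to 1.\<close>

lemma winding_number_rotated_loop:
  assumes p: "path p" "pathfinish p = pathstart p" "0 \<notin> path_image p"
    and wn: "winding_number p 0 = 1"
    and a: "a \<noteq> 0" and disj: "\<And>s t. s \<in> {0..1} \<Longrightarrow> t \<in> {0..1} \<Longrightarrow> a * p t \<noteq> p s"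
    and z: "winding_number p z = 1" "winding_number (\<lambda>t. a * p t) z = 0"
    and z': "winding_number p z' = 0" "winding_number (\<lambda>t. a * p t) z' = 1"
  shows False
proof -
  let ?q = "\<lambda>t. a * p t"
  have q: "path ?q" "pathfinish ?q = pathstart ?q"
    using p by (auto simp: path_def pathstart_def pathfinish_def intro!: continuous_intros)
  have disj': "path_image ?q \<inter> path_image p = {}"
    using disj by (force simp: path_image_def)
  \<comment> \<open>The difference of the two loops is \<open>(a - 1) * p t\<close>, and
    \<open>a = 1\<close> would make them meet.\<close>
  from disj[of 0 0] have "a - 1 \<noteq> 0" by auto
  then have "winding_number (\<lambda>t. (a - 1) * p t) ((a - 1) * 0) = 1"
    using winding_number_scale[OF p(1,3)] wn by metis
  then have "winding_number ?q (p 0) + winding_number p (?q 1) = 1"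
    using winding_number_diff_add[OF q(1) p(1) disj'] by (simp add: algebra_simps)
  \<comment> \<open>Since the mutual winding numbers, of \<open>?q\<close> around \<open>p 0\<close>
    and of \<open>p\<close> around \<open>?q 1\<close>, add up to 1, the point \<open>z\<close>
    forces them to be 0 and 1, while \<open>z'\<close> forces 1 and 0.\<close>
  moreover note winding_number_disjoint_loops[OF q p(1,2) disj', of z]
    winding_number_disjoint_loops[OF q p(1,2) disj', of z']
  ultimately show False using z z' by auto
qed


section \<open>The staircase path in the annulus\<close>

definition cpx :: "real \<times> real \<Rightarrow> complex" where
  "cpx p = Complex (fst p) (snd p)"

lemma Re_cpx [simp]: "Re (cpx p) = fst p" and Im_cpx [simp]: "Im (cpx p) = snd p"
  by (simp_all add: cpx_def)

lemma continuous_on_cpx [continuous_intros]: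
  assumes "continuous_on S f" shows "continuous_on S (\<lambda>x. cpx (f x))"
  unfolding cpx_def Complex_eq using assms by (intro continuous_intros)

lemma norm_wrap:
  "norm (wrap w z) = exp (- (2 * pi * (Im z * Re w - Re z * Im w) / ((Re w)\<^sup>2 + (Im w)\<^sup>2)))"
proof -
  have "Re (2 * of_real pi * \<i> * (z / w)) = - (2 * pi * Im (z / w))" by (simp del: times_divide_eq_right)
  then show ?thesis unfolding wrap_def norm_exp_eq_Re by (simp add: Im_divide)
qed

text \<open>Over a non-integral abscissa the walk can only be on a horizontal segment, so its height
  there is known.\<close>

lemma plane_walk_trace:
  assumes "p \<in> path_image (plane_walk f k)"
  shows "0 \<le> fst p \<and> fst p \<le> real k \<and>
    (fst p \<in> \<int> \<or> (\<exists>j<k. real j \<le> fst p \<and> fst p \<le> real (Suc j) \<and> snd p = height f (Suc j)))"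
  using assms
proof (induction k)
  case 0
  then show ?case by (auto simp: path_image_def linepath_def)
next
  case (Suc k)
  have vert: "fst q = real k" if "q \<in> path_image (linepath (real k, a) (real k, b))" for q a b
    using that by (auto simp: path_image_def linepath_def algebra_simps)
  have hor: "real k \<le> fst q \<and> fst q \<le> real (Suc k) \<and> snd q = a"
    if "q \<in> path_image (linepath (real k, a) (real (Suc k), a))" for q a
    using that by (auto simp: path_image_def linepath_def algebra_simps)
  from Suc.prems consider "p \<in> path_image (plane_walk f k)"
    | "p \<in> path_image (linepath (real k, height f k) (real k, height f (Suc k)))"
    | "p \<in> path_image (linepath (real k, height f (Suc k)) (real (Suc k), height f (Suc k)))"
    unfolding plane_walk.simps using path_image_join_subset by blast
  then show ?case
  proof cases
    case 1
    then show ?thesis using Suc.IH less_Suc_eq by fastforce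
  next
    case 2
    then show ?thesis using vert by fastforce
  next
    case 3
    then have "real k \<le> fst p \<and> fst p \<le> real (Suc k) \<and> snd p = height f (Suc k)" by (rule hor)
    moreover from this have "0 \<le> fst p" by linarith
    ultimately show ?thesis by blast
  qed
qed

text \<open>The vertical line over \<open>x + 1/2\<close> meets the translates of the walk by
  multiples of \<open>V\<close> at one height only. Under \<open>wrap V\<close> its upper part runs
  into \<open>0\<close>, around which the loop winds once, and its lower part runs off to infinity,
  where the winding number is 0.\<close>

lemma winding_number_plane_walk:
  fixes m :: nat and f :: "int \<Rightarrow> int"
  defines "V \<equiv> Complex (real m) (height f m)"
  assumes x: "x < m" and y: "y \<noteq> height f (Suc x)"
  shows "winding_number (\<lambda>t. wrap V (cpx (plane_walk f m t))) (wrap V (Complex (real x + 1/2) y))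
    = (if height f (Suc x) < y then 1 else 0)"
proof -
  let ?g = "plane_walk f m" and ?P = "\<lambda>t. wrap V (cpx (plane_walk f m t))"
  let ?z = "\<lambda>y. wrap V (Complex (real x + 1/2) y)" and ?h = "height f (Suc x)"
  have m: "real m > 0" using x by simp
  then have V: "V \<noteq> 0" by (simp add: V_def complex_eq_iff)
  have ends: "?g 0 = (0, 0)" "?g 1 = (real m, height f m)"
    using plane_walk_endpoints[of f m] by (simp_all add: pathstart_def pathfinish_def)
  have cont: "continuous_on {0..1} ?g" using path_plane_walk by (simp add: path_def)
  have P: "path ?P" using cont by (auto simp: path_def intro!: continuous_intros)
  have "V = 0 + of_int 1 * V" by simp
  then have "wrap V V = wrap V 0" using wrap_eq_iff[OF V] by blast
  then have loop: "pathfinish ?P = pathstart ?P"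
    by (simp add: pathstart_def pathfinish_def ends cpx_def zero_complex.code flip: V_def)
  have avoid: "?z y \<notin> path_image ?P" if "y \<noteq> ?h" for y
  proof
    assume "?z y \<in> path_image ?P"
    then obtain t where t: "t \<in> {0..1}" "?z y = ?P t" by (auto simp: path_image_def)
    then obtain k :: int where k: "Complex (real x + 1/2) y = cpx (?g t) + of_int k * V"
      using wrap_eq_iff[OF V] by blast
    from arg_cong[OF k, of Re] have re: "real x + 1/2 = fst (?g t) + of_int k * real m"
      by (simp add: V_def)
    have g: "?g t \<in> path_image ?g" using t by (auto simp: path_image_def)
    note tr = plane_walk_trace[OF g]
    \<comment> \<open>The walk has abscissas in \<open>[0, m]\<close>, and a nonzero multiple of
      \<open>V\<close> moves them by at least \<open>m\<close>, too far to reach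
      \<open>x + 1/2\<close> in the interior.\<close>
    have "k = 0"
    proof (rule ccontr)
      assume "k \<noteq> 0"
      then consider "real_of_int k \<ge> 1" | "real_of_int k \<le> -1" by linarith
      then show False
      proof cases
        case 1
        then have "1 * real m \<le> of_int k * real m" using m by (intro mult_right_mono) auto
        moreover have "real x + 1 \<le> real m" using x by linarith
        ultimately show False using re tr by linarith
      next
        case 2
        then have "of_int k * real m \<le> -1 * real m" using m by (intro mult_right_mono) auto
        then show False using re tr by linarith
      qed
    qed
    with re have fst: "fst (?g t) = real x + 1/2" by simp
    have "real x + 1/2 \<notin> \<int>"
    proof
      assume "real x + 1/2 \<in> \<int>"
      then obtain i where "real x + 1/2 = of_int i" by (elim Ints_cases)
      then have "of_int (2 * i) = (of_int (2 * int x + 1) :: real)" by simp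
      then show False unfolding of_int_eq_iff by presburger
    qed
    with tr fst obtain j where j: "real j \<le> real x + 1/2" "real x + 1/2 \<le> real (Suc j)"
      "snd (?g t) = height f (Suc j)" by auto
    then have "j = x" by linarith
    with j arg_cong[OF k, of Im] \<open>k = 0\<close> that show False by simp
  qed
  have conn: "connected (?z ` {?h<..})" "connected (?z ` {..<?h})"
    unfolding Complex_eq by (intro connected_continuous_image continuous_intros; simp)+
  have D: "(Re V)\<^sup>2 + (Im V)\<^sup>2 > 0" using V by (simp add: complex_neq_0)
  \<comment> \<open>Along the vertical line the logarithm of the norm is the affine function
    \<open>d - c * y\<close>; its slope is negative because \<open>m > 0\<close>.\<close>
  define c where "c = 2 * pi * real m / ((Re V)\<^sup>2 + (Im V)\<^sup>2)"
  define d where "d = 2 * pi * (real x + 1/2) * Im V / ((Re V)\<^sup>2 + (Im V)\<^sup>2)"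
  have c: "c > 0" using m D by (simp add: c_def)
  have norm: "norm (?z y) = exp (d - c * y)" for y
  proof -
    have "norm (?z y) = exp (- (2 * pi * (y * real m - (real x + 1/2) * Im V) / ((Re V)\<^sup>2 + (Im V)\<^sup>2)))"
      by (simp add: norm_wrap V_def)
    also have "- (2 * pi * (y * real m - (real x + 1/2) * Im V) / ((Re V)\<^sup>2 + (Im V)\<^sup>2)) = d - c * y"
      unfolding c_def d_def using D by (simp add: divide_simps) (simp add: algebra_simps)
    finally show ?thesis .
  qed
  show ?thesis
  proof (cases "?h < y")
    case True
    have "0 \<notin> path_image ?P" by (auto simp: path_image_def)
    moreover have "open (- path_image ?P)" using P by (simp add: closed_path_image open_Compl)
    ultimately obtain e where e: "e > 0" "ball 0 e \<subseteq> - path_image ?P"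
      using open_contains_ball by (metis ComplI)
    have "((\<lambda>y. exp (d - c * y)) \<longlongrightarrow> 0) at_top" using c by real_asymp
    then have "eventually (\<lambda>y. exp (d - c * y) < e) at_top"
      using e(1) by (intro order_tendstoD) auto
    moreover have "eventually (\<lambda>y. y > ?h) at_top" by (rule eventually_gt_at_top)
    ultimately obtain y' where y': "exp (d - c * y') < e" "y' > ?h"
      using eventually_happens'[OF _ eventually_conj] trivial_limit_at_top_linorder by blast
    then have "?z y' \<in> ?z ` {?h<..} \<inter> ball 0 e" using norm by simp
    then have "connected (?z ` {?h<..} \<union> ball 0 e)"
      using conn(1) by (intro connected_Un) auto
    then have "winding_number ?P (?z y) = winding_number ?P 0"
      using e avoid True
      by (intro winding_number_eq[OF P loop, of _ "?z ` {?h<..} \<union> ball 0 e"]) auto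
    also have "\<dots> = 1"
    proof (rule winding_number_wrap[OF _ V])
      show "path (\<lambda>t. cpx (?g t))" using cont by (auto simp: path_def intro!: continuous_intros)
      show "pathfinish (\<lambda>t. cpx (?g t)) = pathstart (\<lambda>t. cpx (?g t)) + 1 * V"
        by (simp add: pathstart_def pathfinish_def ends V_def complex_eq_iff)
    qed
    finally show ?thesis using True by simp
  next
    case False
    then have y': "y < ?h" using y by simp
    obtain R where R: "\<And>z. R \<le> norm z \<Longrightarrow> winding_number ?P z = 0"
      using winding_number_zero_at_infinity[OF P loop] by blast
    have "filterlim (\<lambda>y. exp (d - c * y)) at_top at_bot" using c by real_asymp
    then have "eventually (\<lambda>y. R \<le> exp (d - c * y)) at_bot"
      by (simp add: filterlim_at_top)
    moreover have "eventually (\<lambda>y. y < ?h) at_bot" by (rule eventually_gt_at_bot)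
    ultimately obtain y1 where y1: "R \<le> exp (d - c * y1)" "y1 < ?h"
      using eventually_happens'[OF _ eventually_conj] trivial_limit_at_bot_linorder by blast
    then have "winding_number ?P (?z y) = winding_number ?P (?z y1)"
      using avoid y' conn(2)
      by (intro winding_number_eq[OF P loop, of _ "?z ` {..<?h}"]) auto
    also have "\<dots> = 0" using R y1 norm by simp
    finally show ?thesis using False by simp
  qed
qed


section \<open>Lifting homotopies from the torus\<close>

lemma torus_proj_eq_iff:
  "torus_proj n p = torus_proj n q \<longleftrightarrow> (\<exists>a b::int. q = p + (of_int a * real n, of_int b))"
proof -
  have "torus_proj n p = torus_proj n q \<longleftrightarrow> (p, q) \<in> torus_rel n"
    unfolding torus_proj_def using eq_equiv_class_iff[OF equiv_torus_rel] by blast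
  then show ?thesis by (cases p; cases q) (simp add: torus_rel_iff)
qed

text \<open>The chosen representative need not vary continuously, but invariance makes the choice
  irrelevant, and continuity descends along the quotient map.\<close>

lemma torus_map_factor:
  assumes "continuous_on UNIV \<phi>"
    and "\<And>p q. torus_proj n p = torus_proj n q \<Longrightarrow> \<phi> p = \<phi> q"
  obtains \<psi> where "continuous_map (torus n) euclidean \<psi>" "\<And>p. \<psi> (torus_proj n p) = \<phi> p"
proof
  let ?\<psi> = "\<lambda>C. \<phi> (SOME p. torus_proj n p = C)"
  show eq: "?\<psi> (torus_proj n p) = \<phi> p" for p
    by (rule assms(2)) (rule someI[of _ p], rule refl)
  have "continuous_map euclidean euclidean (?\<psi> \<circ> torus_proj n)"
    using assms(1) eq by (simp add: o_def)
  then show "continuous_map (torus n) euclidean ?\<psi>"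
    by (rule continuous_compose_quotient_map[OF quotient_map_torus_proj])
qed

text \<open>The two coordinates, each wrapped by its own period, give nowhere vanishing functions on
  the torus. Pulled back to the contractible set \<open>S\<close> they have continuous logarithms,
  whose rescaled imaginary parts are the coordinates of a lift.\<close>

lemma torus_map_lift:
  fixes h :: "'a::real_normed_vector \<Rightarrow> (real \<times> real) set"
  assumes n: "n \<ge> 1" and S: "contractible S" and h: "continuous_map (top_of_set S) (torus n) h"
  obtains L where "continuous_on S L" "\<And>w. w \<in> S \<Longrightarrow> torus_proj n (L w) = h w"
proof -
  have n': "real n > 0" "of_nat n \<noteq> (0::complex)" using n by simp_all
  define \<phi>1 \<phi>2 where "\<phi>1 p = wrap (of_nat n) (of_real (fst p))" and "\<phi>2 p = wrap 1 (of_real (snd p))"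
    for p :: "real \<times> real"
  have "continuous_on UNIV \<phi>1" "continuous_on UNIV \<phi>2"
    unfolding \<phi>1_def \<phi>2_def by (intro continuous_intros)+
  moreover have "\<phi>1 p = \<phi>1 q" "\<phi>2 p = \<phi>2 q" if eq: "torus_proj n p = torus_proj n q" for p q
  proof -
    from eq[symmetric] obtain a b :: int where p: "p = q + (of_int a * real n, of_int b)"
      unfolding torus_proj_eq_iff by blast
    show "\<phi>1 p = \<phi>1 q"
      unfolding \<phi>1_def by (subst wrap_eq_iff) (use n in \<open>auto simp: p\<close>)
    show "\<phi>2 p = \<phi>2 q"
      unfolding \<phi>2_def by (subst wrap_eq_iff) (auto simp: p)
  qed
  ultimately obtain \<psi>1 \<psi>2 where \<psi>: "continuous_map (torus n) euclidean \<psi>1"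
    "\<And>p. \<psi>1 (torus_proj n p) = \<phi>1 p" "continuous_map (torus n) euclidean \<psi>2"
    "\<And>p. \<psi>2 (torus_proj n p) = \<phi>2 p"
    using torus_map_factor by metis
  have surj: "\<exists>p. h w = torus_proj n p" if "w \<in> S" for w
  proof -
    have "h w \<in> UNIV // torus_rel n"
      using continuous_map_image_subset_topspace[OF h] that by (auto simp: topspace_torus)
    then show ?thesis by (auto simp: quotient_def torus_proj_def)
  qed
  have "continuous_on S (\<psi>1 \<circ> h)" "continuous_on S (\<psi>2 \<circ> h)"
    using continuous_map_compose[OF h \<psi>(1)] continuous_map_compose[OF h \<psi>(3)] by simp_all
  moreover have "(\<psi>1 \<circ> h) w \<noteq> 0" "(\<psi>2 \<circ> h) w \<noteq> 0" if w: "w \<in> S" for w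
    using surj[OF w] by (auto simp: \<psi> \<phi>1_def \<phi>2_def)
  ultimately obtain g1 g2 where g: "continuous_on S g1" "\<And>w. w \<in> S \<Longrightarrow> (\<psi>1 \<circ> h) w = exp (g1 w)"
    "continuous_on S g2" "\<And>w. w \<in> S \<Longrightarrow> (\<psi>2 \<circ> h) w = exp (g2 w)"
    using continuous_logarithm_on_contractible[OF _ S] by metis
  show thesis
  proof
    let ?L = "\<lambda>w. (real n * Im (g1 w) / (2 * pi), Im (g2 w) / (2 * pi))"
    show "continuous_on S ?L" using g by (intro continuous_intros) auto
    fix w assume w: "w \<in> S"
    from surj[OF w] obtain p where p: "h w = torus_proj n p" by blast
    with g(2)[OF w] g(4)[OF w]
    have "exp (g1 w) = exp (2 * of_real pi * \<i> * (of_real (fst p) / of_nat n))"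
      "exp (g2 w) = exp (2 * of_real pi * \<i> * (of_real (snd p) / 1))"
      by (simp_all add: \<psi> \<phi>1_def \<phi>2_def wrap_def)
    then obtain a b :: int where
      "g1 w = 2 * of_real pi * \<i> * (of_real (fst p) / of_nat n) + (of_int (2 * a) * pi) * \<i>"
      "g2 w = 2 * of_real pi * \<i> * (of_real (snd p) / 1) + (of_int (2 * b) * pi) * \<i>"
      unfolding exp_eq by blast
    then have "g1 w = \<i> * of_real (2 * pi * (fst p / real n) + of_int (2 * a) * pi)"
      "g2 w = \<i> * of_real (2 * pi * snd p + of_int (2 * b) * pi)"
      by (simp_all add: algebra_simps)
    then have "Im (g1 w) = 2 * pi * (fst p / real n) + of_int (2 * a) * pi"
      "Im (g2 w) = 2 * pi * snd p + of_int (2 * b) * pi"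
      by (simp_all only: Im_i_times Re_complex_of_real)
    then have "?L w = p + (of_int a * real n, of_int b)"
      using n' by (cases p) (simp add: field_simps)
    then show "torus_proj n (?L w) = h w"
      unfolding p torus_proj_eq_iff[of n p, symmetric] using torus_proj_eq_iff by metis
  qed
qed

text \<open>Once the first coordinate is divided by \<open>n\<close>, both coordinates are
  continuous and integer-valued on an interval.\<close>

lemma continuous_on_lattice_constant:
  fixes F :: "real \<Rightarrow> real \<times> real"
  assumes n: "n \<ge> (1::nat)" and cont: "continuous_on {0..1} F"
    and lat: "\<And>t. t \<in> {0..1} \<Longrightarrow> \<exists>a b::int. F t = (of_int a * real n, of_int b)"
    and t: "t \<in> {0..1}"
  shows "F t = F 0"
proof -
  have const: "g constant_on {0..1}"
    if "continuous_on {0..1} g" and g: "\<And>t. t \<in> {0..1} \<Longrightarrow> g t \<in> \<int>" for g :: "real \<Rightarrow> real"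
  proof (rule continuous_discrete_range_constant[OF _ that(1)])
    fix x :: real assume "x \<in> {0..1}"
    then have "1 \<le> norm (g y - g x)" if "y \<in> {0..1} \<and> g y \<noteq> g x" for y
      using that g Ints_nonzero_abs_ge1[of "g y - g x"] by simp
    then show "\<exists>e>0. \<forall>y. y \<in> {0..1} \<and> g y \<noteq> g x \<longrightarrow> e \<le> norm (g y - g x)"
      by (intro exI[of _ 1]) auto
  qed simp
  have "(\<lambda>t. fst (F t) / real n) constant_on {0..1}" "(\<lambda>t. snd (F t)) constant_on {0..1}"
    by (rule const; use n cont lat in \<open>force intro!: continuous_intros\<close>)+
  then have "fst (F t) / real n = fst (F 0) / real n" "snd (F t) = snd (F 0)"
    using t unfolding constant_on_def by (metis atLeastAtMost_iff order_refl zero_le_one)+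
  with n show ?thesis by (simp add: prod_eq_iff)
qed

text \<open>Any lift differs from the walk at time 0 by a lattice-valued continuous function, hence
  by a constant, which is subtracted. For the same reason the displacement from start to end stays
  fixed during the homotopy.\<close>

lemma gamma_homotopy_lift:
  assumes n: "n \<ge> 1" and hom: "torus_homotopic n (gamma_loop n r f) p"
  obtains L :: "real \<times> real \<Rightarrow> real \<times> real" where "continuous_on ({0..1} \<times> {0..1}) L"
    "\<And>t. t \<in> {0..1} \<Longrightarrow> L (0, t) = plane_walk f (n * r) t"
    "\<And>s. s \<in> {0..1} \<Longrightarrow> L (s, 1) = L (s, 0) + (real (n * r), height f (n * r))"
    "\<And>w i j. w \<in> {0..1} \<times> {0..1} \<Longrightarrow> L w \<noteq> (of_int i + 1/2, of_int j + 1/2)"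
    "\<And>t. t \<in> {0..1} \<Longrightarrow> torus_proj n (L (1, t)) = p t"
proof -
  let ?S = "{0..1::real} \<times> {0..1::real}" and ?g = "plane_walk f (n * r)"
  from hom obtain h :: "real \<times> real \<Rightarrow> (real \<times> real) set"
    where h: "continuous_map (prod_topology (top_of_set {0..1}) (top_of_set {0..1})) (punctured_torus n) h"
    and h0: "\<And>t. h (0, t) = gamma_loop n r f t" and h1: "\<And>t. h (1, t) = p t"
    and loop: "\<And>s. s \<in> {0..1} \<Longrightarrow> h (s, 1) = h (s, 0)"
    unfolding torus_homotopic_def homotopic_with_def by blast
  have S: "prod_topology (top_of_set {0..1::real}) (top_of_set {0..1::real}) = top_of_set ?S"
    by (rule prod_topology_subtopology_eu)
  from h have h: "continuous_map (top_of_set ?S) (torus n) h"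
    and avoid: "\<And>w. w \<in> ?S \<Longrightarrow> h w \<notin> punctures n"
    unfolding S punctured_torus_def by (auto simp: continuous_map_in_subtopology)
  have "contractible ?S" by (intro convex_imp_contractible convex_Times) auto
  from torus_map_lift[OF n this h] obtain L0 where L0: "continuous_on ?S L0"
    "\<And>w. w \<in> ?S \<Longrightarrow> torus_proj n (L0 w) = h w" by blast
  have cont: "continuous_on {0..1} ?g" using path_plane_walk by (simp add: path_def)
  let ?D = "\<lambda>t. L0 (0, t) - ?g t"
  have lat: "\<exists>a b::int. q - p = (of_int a * real n, of_int b)" if "torus_proj n p = torus_proj n q" for p q
    using that unfolding torus_proj_eq_iff by force
  have D: "\<exists>a b::int. ?D t = (of_int a * real n, of_int b)" if "t \<in> {0..1}" for t
    by (rule lat) (use that L0(2)[of "(0, t)"] in \<open>simp add: h0 gamma_loop_def\<close>)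
  have D0: "?D t = ?D 0" if "t \<in> {0..1}" for t
    by (rule continuous_on_lattice_constant[OF n _ D that])
      (intro continuous_intros cont continuous_on_compose2[OF L0(1)]; auto)
  define L where "L w = L0 w - ?D 0" for w
  have L: "continuous_on ?S L" unfolding L_def by (intro continuous_intros L0)
  obtain a b :: int where ab: "?D 0 = (of_int a * real n, of_int b)" using D[of 0] by auto
  have proj: "torus_proj n (L w) = h w" if "w \<in> ?S" for w
  proof -
    have "L0 w = L w + (of_int a * real n, of_int b)" unfolding L_def ab by simp
    then have "torus_proj n (L w) = torus_proj n (L0 w)" unfolding torus_proj_eq_iff by blast
    with L0(2)[OF that] show ?thesis by simp
  qed
  have L_0: "L (0, t) = ?g t" if "t \<in> {0..1}" for t
    using D0[OF that] by (simp add: L_def algebra_simps)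
  show thesis
  proof
    show "L (s, 1) = L (s, 0) + (real (n * r), height f (n * r))" if "s \<in> {0..1}" for s
    proof -
      have "L (s, 1) - L (s, 0) = L (0, 1) - L (0, 0)"
      proof (rule continuous_on_lattice_constant[OF n _ _ that])
        show "continuous_on {0..1} (\<lambda>s. L (s, 1) - L (s, 0))"
          by (intro continuous_intros continuous_on_compose2[OF L]) auto
        show "\<exists>a b::int. L (s, 1) - L (s, 0) = (of_int a * real n, of_int b)" if "s \<in> {0..1}" for s
          by (rule lat) (use that in \<open>simp add: proj loop\<close>)
      qed
      also have "\<dots> = (real (n * r), height f (n * r))"
        using plane_walk_endpoints[of f "n * r"]
        by (simp add: L_0 pathstart_def pathfinish_def del: of_nat_mult)
      finally show ?thesis by (simp add: algebra_simps)
    qed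
    show "L w \<noteq> (of_int i + 1/2, of_int j + 1/2)" if w: "w \<in> ?S" for w i j
    proof
      assume L: "L w = (of_int i + 1/2, of_int j + 1/2)"
      \<comment> \<open>\<open>punctures\<close> lists only the indices from 0 to
        \<open>n - 1\<close>, so the point is first moved there by a lattice vector.\<close>
      have "i = i mod int n + i div int n * int n" by simp
      then have "real_of_int i = of_int (i mod int n) + of_int (i div int n) * real n"
        by (metis of_int_add of_int_mult of_int_of_nat_eq)
      then have "L w = (of_int (i mod int n) + 1/2, 1/2) + (of_int (i div int n) * real n, of_int j)"
        by (simp add: L)
      then have "torus_proj n (of_int (i mod int n) + 1/2, 1/2) = torus_proj n (L w)"
        unfolding torus_proj_eq_iff by blast
      moreover have "i mod int n \<in> {0..<int n}" using n by simp
      ultimately have "h w \<in> punctures n"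
        unfolding punctures_def proj[OF w, symmetric] by (metis (no_types, lifting) image_eqI)
      with avoid[OF w] show False by blast
    qed
  qed (use L L_0 proj h1 in auto)
qed


section \<open>Ordered translates of a sequence\<close>

lemma int_translation_iterate:
  fixes g :: "int \<Rightarrow> int"
  assumes "\<And>x. g (x + p) = g x + c"
  shows "g (x + k * p) = g x + k * c"
proof (induction k rule: int_induct[where k = 0])
  case (step1 i)
  then show ?case using assms[of "x + i * p"] by (simp add: algebra_simps)
next
  case (step2 i)
  then show ?case using assms[of "x + (i - 1) * p"] by (simp add: algebra_simps)
qed simp

lemma partial_sum_unique:
  assumes "\<And>i. g (i + 1) = g i + d i"
  shows "g i = g 0 + partial_sum d i"
proof (induction i rule: int_induct[where k = 0])
  case (step1 i)
  then show ?case using assms[of i] partial_sum_step[of d i] by simp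
next
  case (step2 i)
  then show ?case using assms[of "i - 1"] partial_sum_step[of d "i - 1"] by simp
qed (simp add: partial_sum_0)

lemma partial_sum_shift:
  assumes "cyclic_seq m f"
  shows "partial_sum f (i + int m) = partial_sum f i + seq_total m f"
proof -
  have "partial_sum f (i + 1 + int m) = partial_sum f (i + int m) + f i" for i
    using partial_sum_step[of f "i + int m"] assms by (simp add: cyclic_seq_def algebra_simps)
  from partial_sum_unique[of "\<lambda>i. partial_sum f (i + int m)", OF this, of i]
  show ?thesis by (simp add: partial_sum_def seq_total_def)
qed

lemma card_multiples_interval:
  fixes a b :: int
  assumes r: "r > 0" and "a \<le> b"
  shows "int (card ({k. int r dvd k} \<inter> {a<..b})) = b div int r - a div int r"
proof -
  have iff: "int r * k \<le> c \<longleftrightarrow> k \<le> c div int r" for k c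
  proof
    assume "int r * k \<le> c"
    from zdiv_mono1[OF this, of "int r"] r show "k \<le> c div int r" by simp
  next
    assume "k \<le> c div int r"
    then have "int r * k \<le> int r * (c div int r)" by (rule mult_left_mono) simp
    also have "\<dots> \<le> c" using r by (metis mult_div_mod_eq pos_mod_sign le_add_same_cancel1 of_nat_0_less_iff)
    finally show "int r * k \<le> c" .
  qed
  have "{k. int r dvd k} \<inter> {a<..b} = (\<lambda>k. int r * k) ` {a div int r<..b div int r}"
    using iff[of _ a] iff[of _ b] by (auto simp: not_le[symmetric] elim!: dvdE)
  moreover have "inj_on (\<lambda>k. int r * k) {a div int r<..b div int r}"
    using r by (auto simp: inj_on_def)
  moreover have "a div int r \<le> b div int r" using assms by (simp add: zdiv_mono1)
  ultimately show ?thesis by (simp add: card_image)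
qed

text \<open>Both signs in the definition give one formula: the standard sequence is the increment of
  the floor of the partial sums divided by \<open>r\<close>.\<close>

lemma standard_seq_eq_div:
  assumes "r > 0"
  shows "standard_seq r d i = partial_sum d (i + 1) div int r - partial_sum d i div int r"
  using assms by (simp add: standard_seq_def card_multiples_interval)

text \<open>Multiplication by \<open>m\<close> permutes the residues modulo \<open>r\<close>, and by
  periodicity \<open>f (i + k * n)\<close> depends only on \<open>k\<close> modulo
  \<open>r\<close>.\<close>

lemma multidegree_reindex:
  assumes "r > 0" and cyc: "cyclic_seq (n * r) f" and cop: "coprime m (int r)"
  shows "(\<Sum>j<r. f (i + int j * (m * int n))) = multidegree n r f i"
proof -
  let ?\<pi> = "\<lambda>j. nat (int j * m mod int r)"
  have "inj_on ?\<pi> {..<r}"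
  proof (rule inj_onI)
    fix j k assume jk: "j \<in> {..<r}" "k \<in> {..<r}" "?\<pi> j = ?\<pi> k"
    then have "int j * m mod int r = int k * m mod int r"
      using assms(1) by (metis eq_nat_nat_iff of_nat_0_less_iff pos_mod_sign)
    then have "int r dvd (int j - int k) * m"
      by (simp add: mod_eq_dvd_iff left_diff_distrib)
    then have "int r dvd int j - int k"
      using cop by (simp add: coprime_commute coprime_dvd_mult_left_iff)
    then have "int j mod int r = int k mod int r" by (simp add: mod_eq_dvd_iff)
    with jk show "j = k" by simp
  qed
  moreover have "?\<pi> ` {..<r} \<subseteq> {..<r}"
    using assms(1) by (auto simp: nat_less_iff)
  ultimately have bij: "bij_betw ?\<pi> {..<r} {..<r}"
    by (simp add: bij_betw_def endo_inj_surj)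
  have "f (i + int j * (m * int n)) = f (i + int (?\<pi> j) * int n)" for j
  proof -
    have per: "f (x + k * (int n * int r)) = f x" for x k
      using int_translation_iterate[of f "int n * int r" 0] cyc by (simp add: cyclic_seq_def)
    have eq: "i + int j * (m * int n)
        = i + (int j * m mod int r) * int n + (int j * m div int r) * (int n * int r)"
    proof -
      have "int j * (m * int n) = (int j * m mod int r + (int j * m div int r) * int r) * int n"
        by (simp only: mod_mult_div_eq mod_div_mult_eq mult.assoc)
      then show ?thesis by (simp only: distrib_right mult.assoc mult.commute[of "int r"] add.assoc)
    qed
    show ?thesis using assms(1) by (simp only: eq per) simp
  qed
  then show ?thesis
    unfolding multidegree_def using sum.reindex_bij_betw[OF bij, of "\<lambda>j. f (i + int j * int n)"]
    by simp
qed

text \<open>The translates of the height function are ordered, and \<open>l \<mapsto> h (i + l m n) - l q\<close>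
  enumerates them in increasing order, gaining exactly 1 after \<open>r\<close> steps. Such a function is
  determined by the sum of \<open>r\<close> consecutive values.\<close>

lemma seq_equiv_standard_if_comparable:
  fixes m q :: int
  assumes r: "r > 0" and cyc: "cyclic_seq (n * r) f"
    and bezout: "m * seq_total (n * r) f = 1 + q * int r"
    and cmp: "(\<forall>i. partial_sum f i \<le> partial_sum f (i + m * int n) - q)
      \<or> (\<forall>i. partial_sum f (i + m * int n) - q \<le> partial_sum f i)"
  shows "seq_equiv n f (standard_seq r (multidegree n r f))"
proof -
  let ?h = "partial_sum f" and ?N = "seq_total (n * r) f"
  define \<phi> where "\<phi> i l = ?h (i + int l * (m * int n)) - int l * q" for i and l :: nat
  define e where "e i = (\<Sum>l<r. \<phi> i l)" for i
  \<comment> \<open>In total the \<open>r\<close> steps move by \<open>m\<close> periods of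
    \<open>f\<close>, which raises \<open>?h\<close> by \<open>m * ?N\<close>; subtracting
    \<open>r * q\<close> leaves 1.\<close>
  have \<phi>_r: "\<phi> i r = \<phi> i 0 + 1" for i
  proof -
    have "?h (i + m * int (n * r)) = ?h i + m * ?N"
      using int_translation_iterate[of ?h, OF partial_sum_shift[OF cyc]] .
    with bezout show ?thesis by (simp add: \<phi>_def algebra_simps)
  qed
  have mono: "mono (\<phi> i)" for i
    using cmp
  proof
    assume *: "\<forall>i. ?h i \<le> ?h (i + m * int n) - q"
    show ?thesis
    proof (unfold mono_iff_le_Suc, rule allI)
      fix l
      show "\<phi> i l \<le> \<phi> i (Suc l)"
        using *[rule_format, of "i + int l * (m * int n)"] by (simp add: \<phi>_def algebra_simps)
    qed
  next
    assume *: "\<forall>i. ?h (i + m * int n) - q \<le> ?h i"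
    have "antimono (\<phi> i)"
    proof (unfold antimono_iff_le_Suc, rule allI)
      fix l
      show "\<phi> i (Suc l) \<le> \<phi> i l"
        using *[rule_format, of "i + int l * (m * int n)"] by (simp add: \<phi>_def algebra_simps)
    qed
    \<comment> \<open>A decreasing chain cannot gain 1, so this alternative is
      contradictory.\<close>
    then have "\<phi> i r \<le> \<phi> i 0" by (rule antimonoD) simp
    with \<phi>_r[of i] show ?thesis by simp
  qed
  \<comment> \<open>All \<open>r\<close> summands of \<open>e i\<close> are
    \<open>\<phi> i 0\<close> or one more, and the first one is exactly \<open>\<phi> i 0\<close>;
    so \<open>e i\<close> exceeds \<open>r * \<phi> i 0\<close> by less than
    \<open>r\<close>.\<close>
  have h: "?h i = e i div int r" for i
  proof -
    have "\<phi> i 0 \<le> \<phi> i l" "\<phi> i l \<le> \<phi> i 0 + 1" if "l < r" for l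
      using monoD[OF mono, of 0 l i] monoD[OF mono, of l r i] \<phi>_r[of i] that by simp_all
    then have "(\<Sum>l<r. \<phi> i 0) \<le> e i" "(\<Sum>l\<in>{..<r} - {0}. \<phi> i l) \<le> (\<Sum>l\<in>{..<r} - {0}. \<phi> i 0 + 1)"
      unfolding e_def by (intro sum_mono; auto)+
    moreover have "e i = \<phi> i 0 + (\<Sum>l\<in>{..<r} - {0}. \<phi> i l)"
      using r unfolding e_def by (intro sum.remove) auto
    ultimately have "int r * \<phi> i 0 \<le> e i" "e i < int r * \<phi> i 0 + int r"
      using r by (simp_all add: of_nat_diff algebra_simps)
    then have "e i div int r = \<phi> i 0"
      by (intro int_div_pos_eq[of _ _ _ "e i - int r * \<phi> i 0"]) auto
    then show ?thesis by (simp add: \<phi>_def)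
  qed
  have "coprime m (int r)"
  proof (rule coprimeI)
    fix c assume "c dvd m" "c dvd int r"
    then have "c dvd m * ?N - q * int r" by simp
    with bezout show "is_unit c" by simp
  qed
  note reindex = multidegree_reindex[OF r cyc this]
  have "e (i + 1) = e i + multidegree n r f i" for i
  proof -
    have "\<phi> (i + 1) l = \<phi> i l + f (i + int l * (m * int n))" for l
      using partial_sum_step[of f "i + int l * (m * int n)"] by (simp add: \<phi>_def algebra_simps)
    then show ?thesis by (simp add: e_def sum.distrib reindex)
  qed
  then have e: "e i = e 0 + partial_sum (multidegree n r f) i" for i
    by (rule partial_sum_unique)
  \<comment> \<open>Modulo \<open>r\<close> each translation by \<open>m * n\<close> adds 1 to
    \<open>e\<close>. Performing it \<open>e 0\<close> times absorbs the constant \<open>e 0\<close>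
    that separates \<open>e\<close> from the partial sums of the multidegree, which yields the shift
    sought.\<close>
  have "e (i + m * int n) = e i + (1 + q * int r)" for i
  proof -
    have "\<phi> (i + m * int n) l = \<phi> i (Suc l) + q" for l by (simp add: \<phi>_def algebra_simps)
    then have "e (i + m * int n) = (\<Sum>l<r. \<phi> i (Suc l)) + int r * q"
      by (simp add: e_def sum.distrib)
    also have "(\<Sum>l<r. \<phi> i (Suc l)) = e i + 1"
      using sum.lessThan_Suc_shift[of "\<phi> i" r] \<phi>_r[of i] by (simp add: e_def)
    finally show ?thesis by (simp add: algebra_simps)
  qed
  from int_translation_iterate[of e, OF this]
  have shift: "e (x + e 0 * (m * int n)) = e x + e 0 * (1 + q * int r)" for x .
  have div: "partial_sum (multidegree n r f) (x + e 0 * (m * int n)) div int r = ?h x + e 0 * q" for x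
  proof -
    have "partial_sum (multidegree n r f) (x + e 0 * (m * int n)) = e x + (e 0 * q) * int r"
      using shift[of x] e[of "x + e 0 * (m * int n)"] by (simp add: algebra_simps)
    then show ?thesis using r h[of x] by simp
  qed
  have "f x = standard_seq r (multidegree n r f) (x + e 0 * (m * int n))" for x
    using div[of x] div[of "x + 1"] partial_sum_step[of f x]
    by (simp add: standard_seq_eq_div[OF r] algebra_simps)
  then show ?thesis unfolding seq_equiv_def by (intro exI[of _ "e 0 * (m * int n)"]) auto
qed


section \<open>Simple loops\<close>

lemma height_eq_partial_sum: "height f k = of_int (partial_sum f (int k))"
proof -
  have "(\<Sum>x<k. f (int x)) = partial_sum f (int k)"
  proof (induction k)
    case (Suc k)
    then show ?case using partial_sum_step[of f "int k"] by (simp add: add.commute)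
  qed (simp add: partial_sum_0)
  then show ?thesis by (simp add: height_def)
qed

lemma real_of_int_half_less_iff: "real_of_int a < real_of_int k + 1/2 \<longleftrightarrow> a \<le> k"
  by linarith

lemma real_of_int_half_neq: "real_of_int k + 1/2 \<noteq> real_of_int a"
proof
  assume "real_of_int k + 1/2 = real_of_int a"
  then have "real_of_int (2 * k + 1) = real_of_int (2 * a)" by simp
  then show False unfolding of_int_eq_iff by presburger
qed

text \<open>The situation after lifting, stated in the plane alone: \<open>L\<close> is the lifted
  homotopy, and simplicity of the final loop becomes a condition on lattice translates of its
  lift.\<close>

locale simple_gamma_lift =
  fixes n r :: nat and f :: "int \<Rightarrow> int" and L :: "real \<times> real \<Rightarrow> real \<times> real"
  assumes n: "n \<ge> 1" and r: "r \<ge> 1" and cyc: "cyclic_seq (n * r) f"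
    and L: "continuous_on ({0..1} \<times> {0..1}) L"
    and L_0: "\<And>t. t \<in> {0..1} \<Longrightarrow> L (0, t) = plane_walk f (n * r) t"
    and L_1: "\<And>s. s \<in> {0..1} \<Longrightarrow> L (s, 1) = L (s, 0) + (real (n * r), height f (n * r))"
    and avoid: "\<And>w i j. w \<in> {0..1} \<times> {0..1} \<Longrightarrow> L w \<noteq> (of_int i + 1/2, of_int j + 1/2)"
    and simple: "\<And>s t a b. s \<in> {0..1} \<Longrightarrow> t \<in> {0..1} \<Longrightarrow>
      L (1, s) = L (1, t) + (of_int a * real n, of_int b) \<Longrightarrow> s = t \<or> (s = 0 \<and> t = 1) \<or> (s = 1 \<and> t = 0)"
begin

definition "N = seq_total (n * r) f"

definition V :: complex where "V = Complex (real (n * r)) (of_int N)"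

definition c :: "real \<Rightarrow> complex" where "c t = cpx (L (1, t))"

lemma height_N: "height f (n * r) = of_int N"
  by (simp add: height_eq_partial_sum N_def partial_sum_def seq_total_def)

lemma V_nonzero: "V \<noteq> 0"
  using n r by (simp add: V_def complex_eq_iff)

lemma path_c: "path c"
  unfolding c_def[abs_def] path_def
  by (intro continuous_intros continuous_on_compose2[OF L]) auto

lemma c_1: "pathfinish c = pathstart c + V"
  using L_1[of 1] by (simp add: pathfinish_def pathstart_def c_def V_def complex_eq_iff height_N)

lemma c_lattice:
  assumes "s \<in> {0..1}" "t \<in> {0..1}" "c s = c t + Complex (of_int a * real n) (of_int b)"
  shows "s = t \<or> (s = 0 \<and> t = 1) \<or> (s = 1 \<and> t = 0)"
proof (rule simple[OF assms(1,2)])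
  show "L (1, s) = L (1, t) + (of_int a * real n, of_int b)"
    using assms(3) by (simp add: c_def complex_eq_iff prod_eq_iff)
qed

text \<open>If \<open>g = gcd r N\<close>, then the simple loop winds \<open>g\<close> times around the annulus
  \<open>\<complex> / \<int> (V / g)\<close>.\<close>

lemma coprime_N: "coprime (int r) N"
proof -
  let ?g = "gcd (int r) N"
  have g: "?g > 0" using r by simp
  obtain r' N' where r': "int r = ?g * r'" and N': "N = ?g * N'"
    using gcd_dvd1[of "int r" N] gcd_dvd2[of "int r" N] by (elim dvdE)
  \<comment> \<open>As the gcd divides both \<open>r\<close> and \<open>N\<close>, the quotient
    \<open>w\<close> of \<open>V\<close> by it is still a lattice vector, so \<open>wrap w\<close>
    keeps the loop simple.\<close>
  define w where "w = Complex (of_int r' * real n) (of_int N')"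
  have "real r = of_int ?g * of_int r'" using arg_cong[OF r', of real_of_int] by simp
  moreover have "real_of_int N = of_int ?g * of_int N'" using arg_cong[OF N', of real_of_int] by simp
  ultimately have V: "V = of_int ?g * w"
    by (simp add: V_def w_def complex_eq_iff)
  with V_nonzero have w: "w \<noteq> 0" by auto
  let ?P = "\<lambda>t. wrap w (c t)"
  have "c 1 = c 0 + of_int ?g * w" using c_1 V by (simp add: pathstart_def pathfinish_def)
  then have "?P 1 = ?P 0" unfolding wrap_eq_iff[OF w] by blast
  moreover have "simple_path ?P"
    unfolding simple_path_def loop_free_def
  proof (intro conjI ballI impI)
    show "path ?P" using path_c by (auto simp: path_def intro!: continuous_intros)
    fix s t :: real assume st: "s \<in> {0..1}" "t \<in> {0..1}" "?P s = ?P t"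
    then obtain k :: int where "c s = c t + of_int k * w" unfolding wrap_eq_iff[OF w] by blast
    then have "c s = c t + Complex (of_int (k * r') * real n) (of_int (k * N'))"
      by (simp add: w_def complex_eq_iff)
    from c_lattice[OF st(1,2) this] show "s = t \<or> s = 0 \<and> t = 1 \<or> s = 1 \<and> t = 0" .
  qed
  moreover have "0 \<notin> path_image ?P" by (auto simp: path_image_def)
  \<comment> \<open>A simple closed path winds at most once in absolute value, which leaves only 1
    for the positive number \<open>?g\<close>.\<close>
  ultimately have "winding_number ?P 0 \<in> {-1, 0, 1}"
    by (intro simple_closed_path_winding_number_cases) (auto simp: pathstart_def pathfinish_def)
  moreover have "winding_number ?P 0 = of_int ?g"
    by (rule winding_number_wrap[OF path_c w]) (simp add: c_1 V)
  ultimately have "(of_int ?g :: complex) \<in> {of_int (-1), of_int 0, of_int 1}" by simp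
  then have "?g \<in> {-1, 0, 1}" unfolding insert_iff of_int_eq_iff empty_iff .
  with g have "?g = 1" by (elim insertE emptyE) linarith+
  then show ?thesis by (simp add: coprime_iff_gcd_eq_1)
qed

abbreviation "loop \<equiv> \<lambda>t. wrap V (c t)"

text \<open>These are the lifts of the punctures, which the lifted homotopy avoids.\<close>

abbreviation half_point :: "int \<Rightarrow> int \<Rightarrow> complex" where
  "half_point x k \<equiv> Complex (of_int x + 1/2) (of_int k + 1/2)"

lemma half_point_shift: "wrap V (half_point (x + j * int (n * r)) (k + j * N)) = wrap V (half_point x k)"
proof -
  have "half_point (x + j * int (n * r)) (k + j * N) = half_point x k + of_int j * V"
    by (simp add: V_def complex_eq_iff)
  then show ?thesis unfolding wrap_eq_iff[OF V_nonzero] by blast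
qed

lemma lift_avoids:
  assumes "w \<in> {0..1} \<times> {0..1}"
  shows "wrap V (cpx (L w)) \<noteq> wrap V (half_point x k)"
proof
  assume "wrap V (cpx (L w)) = wrap V (half_point x k)"
  then obtain j :: int where j: "cpx (L w) = half_point x k + of_int j * V"
    unfolding wrap_eq_iff[OF V_nonzero] by blast
  have "L w = (of_int (x + j * int (n * r)) + 1/2, of_int (k + j * N) + 1/2)"
    using arg_cong[OF j, of Re] arg_cong[OF j, of Im] by (simp add: V_def prod_eq_iff)
  with avoid[OF assms] show False by blast
qed

text \<open>The wrapped homotopy avoids the wrapped puncture, so \<open>loop\<close> may be replaced
  by the wrapped walk. The index is \<open>x + 1\<close> because the horizontal segment over
  \<open>x + 1/2\<close> comes after the vertical move at \<open>x\<close>.\<close>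

lemma winding_number_loop:
  "winding_number loop (wrap V (half_point x k)) = (if partial_sum f (x + 1) \<le> k then 1 else 0)"
proof -
  let ?m = "int (n * r)" and ?z = "wrap V (half_point x k)"
  let ?walk = "\<lambda>t. wrap V (cpx (plane_walk f (n * r) t))"
  have m: "?m > 0" using n r by simp
  \<comment> \<open>The walk covers only the columns 0 to \<open>n * r - 1\<close>; a multiple of
    \<open>V\<close> brings the puncture into this range.\<close>
  define x0 where "x0 = nat (x mod ?m)"
  define j where "j = x div ?m"
  have x0: "x0 < n * r" using m by (simp add: x0_def nat_less_iff del: of_nat_mult)
  have x: "x = int x0 + j * ?m" using m by (simp add: x0_def j_def del: of_nat_mult)
  let ?k = "k - j * N"
  have z: "?z = wrap V (half_point (int x0) ?k)"
    using half_point_shift[of "int x0" j ?k] x by simp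
  have "homotopic_loops (- {?z}) ?walk loop"
    unfolding homotopic_loops
  proof (intro exI[of _ "\<lambda>w. wrap V (cpx (L w))"] conjI ballI)
    show "continuous_on ({0..1} \<times> {0..1}) (\<lambda>w. wrap V (cpx (L w)))"
      by (intro continuous_intros L)
    show "(\<lambda>w. wrap V (cpx (L w))) \<in> {0..1} \<times> {0..1} \<rightarrow> - {?z}"
      using lift_avoids by auto
    fix s :: real assume s: "s \<in> {0..1}"
    have "cpx (L (s, 1)) = cpx (L (s, 0)) + of_int 1 * V"
      using L_1[OF s] by (simp add: V_def complex_eq_iff height_N)
    then have "wrap V (cpx (L (s, 1))) = wrap V (cpx (L (s, 0)))"
      unfolding wrap_eq_iff[OF V_nonzero] by blast
    then show "pathfinish ((\<lambda>w. wrap V (cpx (L w))) \<circ> Pair s) = pathstart ((\<lambda>w. wrap V (cpx (L w))) \<circ> Pair s)"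
      by (simp add: pathfinish_def pathstart_def)
  qed (auto simp: L_0 c_def)
  then have "winding_number loop ?z = winding_number ?walk ?z"
    by (rule winding_number_homotopic_loops[symmetric])
  also have "\<dots> = (if height f (Suc x0) < of_int ?k + 1/2 then 1 else 0)"
  proof -
    have "of_int ?k + 1/2 \<noteq> height f (Suc x0)"
      unfolding height_eq_partial_sum by (rule real_of_int_half_neq)
    from winding_number_plane_walk[OF x0 this] show ?thesis
      unfolding z height_N by (simp add: V_def)
  qed
  also have "\<dots> = (if partial_sum f (int (Suc x0)) \<le> ?k then 1 else 0)"
    unfolding height_eq_partial_sum real_of_int_half_less_iff ..
  also have "partial_sum f (int (Suc x0)) \<le> ?k \<longleftrightarrow> partial_sum f (x + 1) \<le> k"
  proof -
    have "partial_sum f (int (Suc x0) + j * ?m) = partial_sum f (int (Suc x0)) + j * N"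
      using int_translation_iterate[of "partial_sum f", OF partial_sum_shift[OF cyc]]
      unfolding N_def .
    then show ?thesis unfolding x by (simp add: algebra_simps)
  qed
  finally show ?thesis .
qed

text \<open>If neither inequality holds throughout, one puncture lies above the loop and below its
  translate by \<open>u\<close>, and another lies the other way round. This is what
  \<open>winding_number_rotated_loop\<close> excludes.\<close>

lemma translates_comparable:
  assumes "m * N = 1 + q * int r"
  shows "(\<forall>i. partial_sum f i \<le> partial_sum f (i + m * int n) - q)
    \<or> (\<forall>i. partial_sum f (i + m * int n) - q \<le> partial_sum f i)"
proof (rule ccontr)
  let ?h = "partial_sum f"
  assume "\<not> ?thesis"
  then obtain i j where i: "?h (i + m * int n) - q < ?h i" and j: "?h j < ?h (j + m * int n) - q"
    by (auto simp: not_le)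
  define u where "u = Complex (of_int (m * int n)) (of_int q)"
  have loop: "path loop" "pathfinish loop = pathstart loop"
  proof -
    show "path loop" using path_c by (auto simp: path_def intro!: continuous_intros)
    have "c 1 = c 0 + of_int 1 * V" using c_1 by (simp add: pathstart_def pathfinish_def)
    then show "pathfinish loop = pathstart loop"
      using wrap_eq_iff[OF V_nonzero] unfolding pathstart_def pathfinish_def by blast
  qed
  \<comment> \<open>A common point would make \<open>u\<close> an integer multiple of
    \<open>V\<close>, by simplicity; then \<open>m * N = q * r\<close>, against the
    hypothesis.\<close>
  have disj: "wrap V u * loop t \<noteq> loop s" if st: "s \<in> {0..1}" "t \<in> {0..1}" for s t
  proof
    assume "wrap V u * loop t = loop s"
    then have "loop s = wrap V (u + c t)" by (simp add: wrap_add)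
    then obtain k :: int where k: "c s = u + c t + of_int k * V"
      unfolding wrap_eq_iff[OF V_nonzero] by blast
    then have "c s = c t + Complex (of_int (m + k * int r) * real n) (of_int (q + k * N))"
      by (simp add: u_def V_def complex_eq_iff algebra_simps)
    from c_lattice[OF st this] have "\<exists>l::int. c s = c t + of_int l * V"
    proof (elim disjE conjE)
      assume "s = t"
      then show ?thesis by (intro exI[of _ 0]) simp
    next
      assume "s = 0" "t = 1"
      then show ?thesis using c_1 by (intro exI[of _ "-1"]) (simp add: pathstart_def pathfinish_def)
    next
      assume "s = 1" "t = 0"
      then show ?thesis using c_1 by (intro exI[of _ 1]) (simp add: pathstart_def pathfinish_def)
    qed
    then obtain l :: int where "c s = c t + of_int l * V" ..
    with k have u: "u = of_int (l - k) * V" by (simp add: algebra_simps)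
    have "real_of_int (m * int n) = real_of_int ((l - k) * int (n * r))"
      using arg_cong[OF u, of Re] by (simp add: u_def V_def)
    then have "m * int n = ((l - k) * int r) * int n"
      unfolding of_int_eq_iff by (simp add: algebra_simps)
    then have m_eq: "m = (l - k) * int r" using n by simp
    have "real_of_int q = real_of_int ((l - k) * N)"
      using arg_cong[OF u, of Im] by (simp add: u_def V_def)
    then have q_eq: "q = (l - k) * N" unfolding of_int_eq_iff .
    show False using assms unfolding m_eq q_eq by (simp add: mult.commute mult.left_commute)
  qed
  have translate: "winding_number (\<lambda>t. wrap V u * loop t) (wrap V (half_point (i + m * int n - 1) k))
      = (if ?h i \<le> k - q then 1 else 0)" for i k
  proof -
    have "half_point (i + m * int n - 1) k = u + half_point (i - 1) (k - q)"
      by (simp add: u_def complex_eq_iff)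
    then have "wrap V (half_point (i + m * int n - 1) k) = wrap V u * wrap V (half_point (i - 1) (k - q))"
      by (simp add: wrap_add)
    moreover have "wrap V (half_point (i - 1) (k - q)) \<notin> path_image loop"
    proof
      assume "wrap V (half_point (i - 1) (k - q)) \<in> path_image loop"
      then obtain t where "t \<in> {0..1}" "wrap V (half_point (i - 1) (k - q)) = loop t"
        unfolding path_image_def by blast
      moreover from this have "loop t \<noteq> wrap V (half_point (i - 1) (k - q))"
        unfolding c_def by (intro lift_avoids) simp
      ultimately show False by simp
    qed
    ultimately have "winding_number (\<lambda>t. wrap V u * loop t) (wrap V (half_point (i + m * int n - 1) k))
        = winding_number loop (wrap V (half_point (i - 1) (k - q)))"
      using winding_number_scale[OF loop(1)] by (simp only: wrap_nonzero not_False_eq_True)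
    then show ?thesis unfolding winding_number_loop by (simp only: diff_add_cancel)
  qed
  show False
  proof (rule winding_number_rotated_loop[OF loop])
    show "0 \<notin> path_image loop" by (auto simp: path_image_def)
    show "winding_number loop 0 = 1"
      by (rule winding_number_wrap[OF path_c V_nonzero]) (simp add: c_1)
    show "wrap V u \<noteq> 0" by simp
    \<comment> \<open>The lowest half-point above the loop in this column is still below the
      translated loop, by the choice of \<open>i\<close>. The next witness, for \<open>j\<close>, is
      the lowest one above the translate.\<close>
    show "winding_number loop (wrap V (half_point (i + m * int n - 1) (?h (i + m * int n)))) = 1"
      unfolding winding_number_loop by simp
    show "winding_number (\<lambda>t. wrap V u * loop t) (wrap V (half_point (i + m * int n - 1) (?h (i + m * int n)))) = 0"
      unfolding translate using i by simp
    show "winding_number loop (wrap V (half_point (j + m * int n - 1) (?h j + q))) = 0"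
      unfolding winding_number_loop using j by simp
    show "winding_number (\<lambda>t. wrap V u * loop t) (wrap V (half_point (j + m * int n - 1) (?h j + q))) = 1"
      unfolding translate by simp
  qed (rule disj)
qed

lemma seq_equiv_standard: "seq_equiv n f (standard_seq r (multidegree n r f))"
proof -
  obtain u v where "u * int r + v * N = 1"
    using bezout_int[of "int r" N] coprime_N by (auto simp: coprime_iff_gcd_eq_1)
  then have *: "v * N = 1 + (- u) * int r" by simp
  show ?thesis
    by (rule seq_equiv_standard_if_comparable[OF _ cyc *[unfolded N_def] translates_comparable[OF *]])
      (use r in simp)
qed

end

theorem proposition8p29:
  fixes n r :: nat and f :: "int \<Rightarrow> int"
  assumes "n \<ge> 1" and "r \<ge> 1"
    and "cyclic_seq (n * r) f"
    and "\<exists>p \<in> gamma_class n r f. simple_torus_loop n p"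
  shows "coprime (int r) (seq_total (n * r) f)
    \<and> seq_equiv n f (standard_seq r (multidegree n r f))"
proof -
  from assms(4) obtain p where hom: "torus_homotopic n (gamma_loop n r f) p"
    and p: "p 0 = p 1" "inj_on p {0..<1}"
    by (auto simp: gamma_class_def simple_torus_loop_def torus_loop_def)
  obtain L :: "real \<times> real \<Rightarrow> real \<times> real" where L: "continuous_on ({0..1} \<times> {0..1}) L"
    "\<And>t. t \<in> {0..1} \<Longrightarrow> L (0, t) = plane_walk f (n * r) t"
    "\<And>s. s \<in> {0..1} \<Longrightarrow> L (s, 1) = L (s, 0) + (real (n * r), height f (n * r))"
    "\<And>w i j. w \<in> {0..1} \<times> {0..1} \<Longrightarrow> L w \<noteq> (of_int i + 1/2, of_int j + 1/2)"
    and proj: "\<And>t. t \<in> {0..1} \<Longrightarrow> torus_proj n (L (1, t)) = p t"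
    using gamma_homotopy_lift[OF assms(1) hom] by blast
  interpret simple_gamma_lift n r f L
  proof
    fix s t :: real and a b :: int
    assume st: "s \<in> {0..1}" "t \<in> {0..1}" and "L (1, s) = L (1, t) + (of_int a * real n, of_int b)"
    then have "torus_proj n (L (1, t)) = torus_proj n (L (1, s))"
      unfolding torus_proj_eq_iff by blast
    with st have eq: "p s = p t" by (simp add: proj)
    \<comment> \<open>Injectivity is given on the half-open interval only, so the parameter 1 is
      first replaced by 0.\<close>
    let ?\<rho> = "\<lambda>x::real. if x = 1 then 0 else x"
    have "?\<rho> s = ?\<rho> t"
    proof (rule inj_onD[OF p(2)])
      show "p (?\<rho> s) = p (?\<rho> t)" by (metis eq p(1))
    qed (use st in \<open>simp_all split: if_split\<close>)
    then show "s = t \<or> (s = 0 \<and> t = 1) \<or> (s = 1 \<and> t = 0)" by (simp split: if_splits)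
  qed (fact assms(1-3) L)+
  show ?thesis using coprime_N seq_equiv_standard by (simp add: N_def)
qed

end
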